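(* Let $\mathbf{A}=\mathbf{Q}_{1}\mathbf{\Lambda}_{1}$ and $\mathbf{B}=\mathbf{Q}_{2}\mathbf{\Lambda}_{2}$ in $\mathbb{C}^{m\times m}$ be random matrices, where $\mathbf{Q}_{j}$ and $\mathbf{\Lambda}_{j}$ are sampled independently of each other for $j=1,2$. Moreover, let $\mathbf{\Lambda}_{1}=\operatorname{diag}(\lambda_{1},\dots,\lambda_{m})$ and $\mathbf{\Lambda}_{2}=\operatorname{diag}(\eta_{1},\dots,\eta_{m})$ with $\lambda_{j},\eta_{j}\in \mathrm{U}(1)$ for $j=1,\dots,m$. If $\mathbb{E}[\eta_{j}\lambda_{j}^{*}]=0$ for all $j=1,\dots,m$, then $\mathbb{E}[\operatorname{tr}(\mathbf{A}\mathbf{B}^{\dagger})]=0$.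
   Context: Here $m\ge 1$ is an integer, and $\mathbf{Q}_1,\mathbf{Q}_2,\mathbf{\Lambda}_1,\mathbf{\Lambda}_2$ are random matrices in $\mathbb{C}^{m\times m}$. $\mathrm{U}(1)=\{z\in\mathbb{C}:|z|=1\}$. For $z\in\mathbb{C}$, $z^{*}$ denotes the complex conjugate; for a complex matrix $\mathbf{M}$, $\mathbf{M}^{\dagger}$ denotes the conjugate transpose; $\operatorname{tr}$ is the trace, $\operatorname{diag}(\cdot)$ is the diagonal matrix with the given entries, and $\mathbb{E}$ is expectation.
   Formalization: The independence is taken jointly: the pair (Q1,Q2) is independent of the pair (Λ1,Λ2). Independence of Qj and Λj for each j separately is not enough: for m=1, Λ1=Q2=1, Λ2=Q1=η uniform on U(1), the expected trace is 1. *)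

theory Defs
  imports "HOL-Analysis.Analysis" "HOL-Probability.Probability"
begin

definition conj_transpose :: "complex ^ 'n ^ 'm \<Rightarrow> complex ^ 'm ^ 'n" where
  "conj_transpose A = (\<chi> i j. cnj (A $ j $ i))"

definition diag :: "'a::zero ^ 'n \<Rightarrow> 'a ^ 'n ^ 'n" where
  "diag v = (\<chi> i j. if i = j then v $ i else 0)"

definition U1 :: "complex set" where
  "U1 = {z. cmod z = 1}"

end

theory Submission
  imports Defs
begin

text \<open>
  Written out in entries, the trace is a finite sum
  of terms \<open>q\<^sub>i\<^sub>j u\<^sub>j\<close> with \<open>q\<^sub>i\<^sub>j\<close> depending on the \<open>Q\<close>s and \<open>u\<^sub>j\<close> on the \<open>\<Lambda>\<close>s. No moment
  of the \<open>Q\<close>s is assumed, so a single term need not be integrable and linearity of the expectation is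
  not available. Instead, if the whole sum is integrable, Fubini on the product law lets one integrate
  over the \<open>\<Lambda>\<close>s first with the \<open>Q\<close>s fixed, where every term is bounded and has mean zero; if it is not
  integrable, its Bochner integral is zero by convention.
\<close>

lemma (in prob_space) integral_sum_indep_mean_zero:
  fixes f :: "'i \<Rightarrow> 'b \<Rightarrow> 'd::{real_normed_field, banach, second_countable_topology}"
    and g :: "'i \<Rightarrow> 'b \<Rightarrow> 'd"
  assumes indep: "indep_var S X T Y"
    and f: "\<And>k. k \<in> I \<Longrightarrow> f k \<in> borel_measurable S"
    and g: "\<And>k. k \<in> I \<Longrightarrow> g k \<in> borel_measurable T"
    and int: "\<And>k. k \<in> I \<Longrightarrow> integrable M (\<lambda>\<omega>. g k (Y \<omega>))"
    and zero: "\<And>k. k \<in> I \<Longrightarrow> (LINT \<omega>|M. g k (Y \<omega>)) = 0"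
  shows "(LINT \<omega>|M. (\<Sum>k\<in>I. f k (X \<omega>) * g k (Y \<omega>))) = 0"
proof (cases "integrable M (\<lambda>\<omega>. (\<Sum>k\<in>I. f k (X \<omega>) * g k (Y \<omega>)))")
  case False
  then show ?thesis by (rule not_integrable_integral_eq)
next
  case True
  have X[measurable]: "random_variable S X" and Y[measurable]: "random_variable T Y"
    using indep by (auto dest: indep_var_rv1 indep_var_rv2)
  note f[measurable] g[measurable]
  define PX where "PX = distr M S X"
  define PY where "PY = distr M T Y"
  define F where "F = (\<lambda>(x, y). (\<Sum>k\<in>I. f k x * g k y))"
  interpret PX: prob_space PX unfolding PX_def by (rule prob_space_distr) fact
  interpret PY: prob_space PY unfolding PY_def by (rule prob_space_distr) fact
  interpret PXY: pair_prob_space PX PY ..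
  have law: "PX \<Otimes>\<^sub>M PY = distr M (S \<Otimes>\<^sub>M T) (\<lambda>\<omega>. (X \<omega>, Y \<omega>))"
    using indep by (simp add: indep_var_distribution_eq PX_def PY_def)
  have F[measurable]: "F \<in> borel_measurable (S \<Otimes>\<^sub>M T)"
    unfolding F_def by measurable
  have "integrable (PX \<Otimes>\<^sub>M PY) F"
    using True by (simp add: law integrable_distr_eq F_def)
  \<comment> \<open>\<open>integral_fst\<close> expects a curried integrand;
    \<open>case_prod (curry F)\<close> is \<open>F\<close> in that shape.\<close>
  then have int_F: "integrable (PX \<Otimes>\<^sub>M PY) (case_prod (curry F))"
    by simp
  have gY: "integrable PY (g k)" "(LINT y|PY. g k y) = 0" if "k \<in> I" for k
    using that int zero by (simp_all add: PY_def integrable_distr_eq integral_distr)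
  have "(LINT \<omega>|M. (\<Sum>k\<in>I. f k (X \<omega>) * g k (Y \<omega>))) = (LINT p|(PX \<Otimes>\<^sub>M PY). F p)"
    by (simp add: law integral_distr F_def)
  also have "\<dots> = (LINT x|PX. LINT y|PY. F (x, y))"
    using PXY.integral_fst[OF int_F] by simp
  also have "\<dots> = 0"
    by (simp add: F_def gY)
  finally show ?thesis .
qed

lemma borel_measurable_matrix_entry [measurable]:
  "(\<lambda>A. A $ i $ j) \<in> borel_measurable (borel :: ('a::euclidean_space ^ 'n ^ 'm) measure)"
  by (intro borel_measurable_continuous_onI continuous_intros)

lemma diag_nth_nth: "diag v $ j $ j = v $ j"
  by (simp add: diag_def)

text \<open>Right multiplication by a diagonal matrix scales column \<open>j\<close> by its
  \<open>j\<close>-th entry, so in the Frobenius inner product of the two matrices the diagonal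
  factors separate from the entries of \<open>P\<close> and \<open>Q\<close>.\<close>

lemma trace_mult_conj_transpose_diag:
  "trace ((P ** diag u) ** conj_transpose (Q ** diag v)) =
    (\<Sum>(i, j)\<in>UNIV. P $ i $ j * cnj (Q $ i $ j) * (u $ j * cnj (v $ j)))"
  by (simp add: trace_def matrix_matrix_mult_def conj_transpose_def diag_def if_distrib if_distribR
      sum.cartesian_product flip: UNIV_Times_UNIV cong: if_cong) (simp add: ac_simps)

text \<open>Independence is between the pairs, since the trace mixes all four matrices. Independence
  of \<open>Q1\<close> from \<Lambda>1 and of \<open>Q2\<close> from \<Lambda>2 alone would not
  suffice: for size 1 take \<Lambda>1 uniform on the circle, \<open>Q2\<close> equal to \<Lambda>1,
  and \<open>Q1\<close> and \<Lambda>2 equal to 1; the trace is then constantly 1.\<close>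

theorem proposition1:
  fixes M :: "'w measure"
    and A B Q1 Q2 \<Lambda>1 \<Lambda>2 :: "'w \<Rightarrow> complex ^ 'm ^ 'm"
    and lam eta :: "'w \<Rightarrow> complex ^ 'm"
  assumes prob: "prob_space M"
    and rv_Q: "Q1 \<in> borel_measurable M" "Q2 \<in> borel_measurable M"
    and rv_L: "\<Lambda>1 \<in> borel_measurable M" "\<Lambda>2 \<in> borel_measurable M"
    and A: "\<And>\<omega>. \<omega> \<in> space M \<Longrightarrow> A \<omega> = Q1 \<omega> ** \<Lambda>1 \<omega>"
    and B: "\<And>\<omega>. \<omega> \<in> space M \<Longrightarrow> B \<omega> = Q2 \<omega> ** \<Lambda>2 \<omega>"
    and indep: "prob_space.indep_var M
          (borel \<Otimes>\<^sub>M borel) (\<lambda>\<omega>. (Q1 \<omega>, Q2 \<omega>))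
          (borel \<Otimes>\<^sub>M borel) (\<lambda>\<omega>. (\<Lambda>1 \<omega>, \<Lambda>2 \<omega>))"
    and L1: "\<And>\<omega>. \<omega> \<in> space M \<Longrightarrow> \<Lambda>1 \<omega> = diag (lam \<omega>)"
    and L2: "\<And>\<omega>. \<omega> \<in> space M \<Longrightarrow> \<Lambda>2 \<omega> = diag (eta \<omega>)"
    and lam_U1: "\<And>\<omega> j. \<omega> \<in> space M \<Longrightarrow> lam \<omega> $ j \<in> U1"
    and eta_U1: "\<And>\<omega> j. \<omega> \<in> space M \<Longrightarrow> eta \<omega> $ j \<in> U1"
    and mean_zero: "\<And>j. (LINT \<omega>|M. eta \<omega> $ j * cnj (lam \<omega> $ j)) = 0"
  shows "(LINT \<omega>|M. trace (A \<omega> ** conj_transpose (B \<omega>))) = 0"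
proof -
  interpret prob_space M by (rule prob)
  note rv_Q[measurable] rv_L[measurable]
  define f :: "'m \<times> 'm \<Rightarrow> (complex ^ 'm ^ 'm) \<times> (complex ^ 'm ^ 'm) \<Rightarrow> complex"
    where "f = (\<lambda>(i, j) (P, Q). P $ i $ j * cnj (Q $ i $ j))"
  \<comment> \<open>The phases are read off the matrices, not off \<open>lam\<close> and
    \<open>eta\<close>: measurability and independence are given for \<Lambda>1 and \<Lambda>2. The
    row index \<open>i\<close> only aligns the index set with that of \<open>f\<close>.\<close>
  define g :: "'m \<times> 'm \<Rightarrow> (complex ^ 'm ^ 'm) \<times> (complex ^ 'm ^ 'm) \<Rightarrow> complex"
    where "g = (\<lambda>(i, j) (P, Q). P $ j $ j * cnj (Q $ j $ j))"
  have [measurable]: "cnj \<in> borel_measurable borel"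
    by (intro borel_measurable_continuous_onI continuous_intros)
  have f: "f k \<in> borel_measurable (borel \<Otimes>\<^sub>M borel)" for k
    by (cases k) (simp add: f_def, measurable)
  have g[measurable]: "g k \<in> borel_measurable (borel \<Otimes>\<^sub>M borel)" for k
    by (cases k) (simp add: g_def, measurable)
  \<comment> \<open>The trace produces the conjugate of the product in \<open>mean_zero\<close>;
    conjugation commutes with the integral.\<close>
  have g_eq: "g (i, j) (\<Lambda>1 \<omega>, \<Lambda>2 \<omega>) = cnj (eta \<omega> $ j * cnj (lam \<omega> $ j))"
    if "\<omega> \<in> space M" for i j \<omega>
    using that by (simp add: g_def L1 L2 diag_nth_nth)
  \<comment> \<open>A vanishing Bochner integral does not imply integrability; that comes from the
    modulus being 1 on a probability space.\<close>
  have g_int: "integrable M (\<lambda>\<omega>. g k (\<Lambda>1 \<omega>, \<Lambda>2 \<omega>))" for k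
    using lam_U1 eta_U1
    by (intro integrable_const_bound[where B = 1] AE_I2; cases k)
      (simp_all add: g_eq norm_mult U1_def)
  have g_zero: "(LINT \<omega>|M. g k (\<Lambda>1 \<omega>, \<Lambda>2 \<omega>)) = 0" for k
  proof (cases k)
    case (Pair i j)
    have "(LINT \<omega>|M. g k (\<Lambda>1 \<omega>, \<Lambda>2 \<omega>)) = (LINT \<omega>|M. cnj (eta \<omega> $ j * cnj (lam \<omega> $ j)))"
      unfolding Pair by (intro Bochner_Integration.integral_cong refl g_eq)
    also have "\<dots> = 0"
      by (simp only: Bochner_Integration.integral_cnj mean_zero complex_cnj_zero)
    finally show ?thesis .
  qed
  have "(LINT \<omega>|M. trace (A \<omega> ** conj_transpose (B \<omega>))) =
      (LINT \<omega>|M. (\<Sum>k\<in>UNIV. f k (Q1 \<omega>, Q2 \<omega>) * g k (\<Lambda>1 \<omega>, \<Lambda>2 \<omega>)))"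
    by (intro Bochner_Integration.integral_cong refl)
      (simp add: A B L1 L2 trace_mult_conj_transpose_diag f_def g_def diag_nth_nth case_prod_unfold)
  also have "\<dots> = 0"
    using indep f g g_int g_zero by (intro integral_sum_indep_mean_zero)
  finally show ?thesis .
qed

end
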